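(* Let $n\ge 1$, let $\gamma: I\to\mathbb{E}^3$ be a unit-speed $(n+2)$-times differentiable regular curve with Frenet frame $\{T,N,B\}$, let $1\le k\le n$, and let $\gamma_k$ be the $k$-principal direction curve of $\gamma$. Then $\gamma$ is an $N_k$-slant helix if and only if $\gamma_k$ is a slant helix.
   Context: $I\subset\mathbb{R}$ is an interval and $\mathbb{E}^3$ is Euclidean 3-space. For a unit-speed curve with nonvanishing second derivative, the Frenet frame is $T=\gamma'$, $N=\gamma''/\|\gamma''\|$, $B=T\times N$. Principal direction curves: let $\gamma_0(s)=\int T(s)\,ds$ be the tangent direction curve of $\gamma$ (a translate of $\gamma$, with frame $T_0=T$, $N_0=N$, $B_0=B$). Recursively for $1\le k\le n$, the $k$-principal direction curve of $\gamma$ is $\gamma_k(s)=\int N_{k-1}(s)\,ds$, where $N_{k-1}$ is the principal normal vector of $\gamma_{k-1}$. It is parametrized by the same arc-length parameter $s$ as $\gamma$ and has Frenet frame $T_k=N_{k-1}$, $N_k=N_{k-1}'/\|N_{k-1}'\|$, $B_k=T_k\times N_k$. The original curve $\gamma$ is called the main curve of $\gamma_k$. It is assumed that $\gamma''\neq 0$ everywhere, so that these frames exist. A curve is a slant helix if its principal normal vector makes a constant angle with a fixed direction. The curve $\gamma$ is an $N_k$-slant helix if the principal normal vector $N_k$ of $\gamma_k$ makes a constant angle with a fixed line (called the axis), i.e. there is a fixed unit vector $\vec u$ with $\langle N_k,\vec u\rangle$ constant. *)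

theory Defs
  imports "HOL-Analysis.Analysis"
begin

text \<open>
  Curves are functions \<^typ>\<open>real \<Rightarrow> real^3\<close> of which only the restriction to an interval
  \<open>I\<close> matters. All derivatives are taken within \<open>I\<close> (one-sided at endpoints belonging to \<open>I\<close>), so
  \<open>I\<close> may be open, closed, half-open or unbounded, but it must not be degenerate.
\<close>

definition vderiv :: "real set \<Rightarrow> (real \<Rightarrow> real^3) \<Rightarrow> real \<Rightarrow> real^3" where
  "vderiv I f = (\<lambda>s. vector_derivative f (at s within I))"

primrec times_differentiable_on :: "nat \<Rightarrow> (real \<Rightarrow> real^3) \<Rightarrow> real set \<Rightarrow> bool" where
  "times_differentiable_on 0 f I \<longleftrightarrow> True"
| "times_differentiable_on (Suc m) f I \<longleftrightarrow>
     f differentiable_on I \<and> times_differentiable_on m (vderiv I f) I"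

definition antiderivative_on :: "real set \<Rightarrow> (real \<Rightarrow> real^3) \<Rightarrow> (real \<Rightarrow> real^3) \<Rightarrow> bool" where
  "antiderivative_on I V c \<longleftrightarrow> (\<forall>s\<in>I. (c has_vector_derivative V s) (at s within I))"

definition unit_speed_curve :: "real set \<Rightarrow> (real \<Rightarrow> real^3) \<Rightarrow> bool" where
  "unit_speed_curve I c \<longleftrightarrow> c differentiable_on I \<and> (\<forall>s\<in>I. norm (vderiv I c s) = 1)"

definition frenet_T :: "real set \<Rightarrow> (real \<Rightarrow> real^3) \<Rightarrow> real \<Rightarrow> real^3" where
  "frenet_T I c s = vderiv I c s"

definition frenet_N :: "real set \<Rightarrow> (real \<Rightarrow> real^3) \<Rightarrow> real \<Rightarrow> real^3" where
  "frenet_N I c s = vderiv I (vderiv I c) s /\<^sub>R norm (vderiv I (vderiv I c) s)"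

definition frenet_B :: "real set \<Rightarrow> (real \<Rightarrow> real^3) \<Rightarrow> real \<Rightarrow> real^3" where
  "frenet_B I c s = cross3 (frenet_T I c s) (frenet_N I c s)"

text \<open>Existence of the frame formed by the three vector fields above:\<close>

definition has_frenet_frame :: "real set \<Rightarrow> (real \<Rightarrow> real^3) \<Rightarrow> bool" where
  "has_frenet_frame I c \<longleftrightarrow>
     unit_speed_curve I c \<and> vderiv I c differentiable_on I \<and>
     (\<forall>s\<in>I. vderiv I (vderiv I c) s \<noteq> 0)"

text \<open>
  The indefinite integrals below leave the constants of integration free, hence a relation:
  \<open>principal_direction_curve I \<gamma> k c\<close> says that \<open>c\<close> is a \<open>k\<close>-principal direction curve of \<open>\<gamma>\<close>
  (for \<open>k = 0\<close>: its tangent direction curve, a translate of \<open>\<gamma>\<close>).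
\<close>

primrec principal_direction_curve ::
    "real set \<Rightarrow> (real \<Rightarrow> real^3) \<Rightarrow> nat \<Rightarrow> (real \<Rightarrow> real^3) \<Rightarrow> bool" where
  "principal_direction_curve I \<gamma> 0 c \<longleftrightarrow> antiderivative_on I (frenet_T I \<gamma>) c"
| "principal_direction_curve I \<gamma> (Suc k) c \<longleftrightarrow>
     (\<exists>d. principal_direction_curve I \<gamma> k d \<and> antiderivative_on I (frenet_N I d) c)"

text \<open>
  The vector fields \<open>N\<^sub>k\<close>, computed from \<open>\<gamma>\<close> alone: \<open>N\<^sub>0 = N\<close> and
  \<open>N\<^sub>k\<close> is the normalised derivative of \<open>N\<^bsub>k-1\<^esub> = T\<^sub>k\<close>.
\<close>

primrec principal_normal :: "real set \<Rightarrow> (real \<Rightarrow> real^3) \<Rightarrow> nat \<Rightarrow> real \<Rightarrow> real^3" where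
  "principal_normal I \<gamma> 0 = frenet_N I \<gamma>"
| "principal_normal I \<gamma> (Suc k) =
     (\<lambda>s. vderiv I (principal_normal I \<gamma> k) s /\<^sub>R norm (vderiv I (principal_normal I \<gamma> k) s))"

definition constant_angle_with :: "real set \<Rightarrow> (real \<Rightarrow> real^3) \<Rightarrow> real^3 \<Rightarrow> bool" where
  "constant_angle_with I V u \<longleftrightarrow>
     (\<exists>\<theta>\<in>{0..pi}. \<forall>s\<in>I. V s \<bullet> u = norm (V s) * norm u * cos \<theta>)"

definition slant_helix :: "real set \<Rightarrow> (real \<Rightarrow> real^3) \<Rightarrow> bool" where
  "slant_helix I c \<longleftrightarrow>
     has_frenet_frame I c \<and> (\<exists>u. norm u = 1 \<and> constant_angle_with I (frenet_N I c) u)"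

definition N_slant_helix :: "real set \<Rightarrow> nat \<Rightarrow> (real \<Rightarrow> real^3) \<Rightarrow> bool" where
  "N_slant_helix I k \<gamma> \<longleftrightarrow>
     (\<exists>u. norm u = 1 \<and> (\<exists>a. \<forall>s\<in>I. principal_normal I \<gamma> k s \<bullet> u = a))"

end

theory Submission
  imports Defs
begin

text \<open>
  Two curves with the same principal normal satisfy the same angle condition, so the content of the
  theorem is that a \<open>k\<close>-principal direction curve \<open>\<gamma>\<^sub>k\<close> always has a Frenet frame, with principal
  normal \<open>N\<^sub>k\<close>. Being a slant helix requires this frame, being an \<open>N\<^sub>k\<close>-slant helix does not.

  Let \<open>D V = V' / |V'|\<close>. Then \<open>N\<^sub>k\<close> is obtained from \<open>\<gamma>'\<close> by \<open>k + 1\<close> applications of \<open>D\<close>, and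
  \<open>\<gamma>\<^sub>k\<close> has tangent \<open>D\<^sup>k \<gamma>'\<close>. Two facts about \<open>D\<close> suffice. Nonvanishing of the derivative is
  inherited (\<open>regular_unit_field_normalized_deriv\<close>): if \<open>V\<close> is a unit field and \<open>N = D V\<close> then
  \<open>\<langle>V, N\<rangle> = 0\<close>; differentiating gives \<open>\<langle>V, N'\<rangle> = - \<langle>V', N\<rangle> = - |V'|\<close>, which is not zero. And each
  application of \<open>D\<close> costs at most one order of differentiability
  (\<open>has_derivs_on_normalized_deriv\<close>). Since \<open>\<gamma>'\<close> is \<open>n + 1\<close> times differentiable, \<open>D\<^sup>k \<gamma>'\<close> is still
  differentiable when \<open>k \<le> n\<close>, as the frame of \<open>\<gamma>\<^sub>k\<close> demands.
\<close>

section \<open>Derivatives within a set without isolated points\<close>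

lemma vderiv_eqI:
  assumes "s islimpt I" and "(f has_vector_derivative f') (at s within I)"
  shows "vderiv I f s = f'"
  unfolding vderiv_def
  by (rule vector_derivative_within) (use assms in \<open>auto simp: trivial_limit_within\<close>)

lemma has_vector_derivative_vderiv:
  assumes "f differentiable_on I" and "s \<in> I"
  shows "(f has_vector_derivative vderiv I f s) (at s within I)"
  using assms unfolding vderiv_def differentiable_on_def
  by (simp add: vector_derivative_works)

lemma vderiv_cong:
  assumes "s \<in> I" and "\<And>t. t \<in> I \<Longrightarrow> f t = g t"
  shows "vderiv I f s = vderiv I g s"
proof -
  have "(f has_vector_derivative d) (at s within I) \<longleftrightarrow> (g has_vector_derivative d) (at s within I)"
    for d
    using has_vector_derivative_transform[OF assms(1), of g f d]
      has_vector_derivative_transform[OF assms(1), of f g d] assms(2) by auto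
  then show ?thesis
    unfolding vderiv_def vector_derivative_def by simp
qed

lemma islimpt_nondegenerate_interval:
  fixes I :: "real set"
  assumes "is_interval I" and "interior I \<noteq> {}" and "s \<in> I"
  shows "s islimpt I"
proof (rule connected_imp_perfect)
  show "connected I" using assms(1) by (simp add: is_interval_connected)
  show "I \<noteq> {x}" for x using assms(2) by (metis interior_singleton)
qed fact

section \<open>Repeated differentiability and normalisation\<close>

text \<open>
  Products and the function \<open>x \<mapsto> 1 / sqrt x\<close> have to be differentiated repeatedly, so vector and
  scalar functions are needed together, and derivatives are given by witnesses: this lets the
  product rule be used without computing any derivative explicitly.
\<close>

primrec has_derivs_on :: "nat \<Rightarrow> (real \<Rightarrow> 'a::real_normed_vector) \<Rightarrow> real set \<Rightarrow> bool" where
  "has_derivs_on 0 f I \<longleftrightarrow> True"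
| "has_derivs_on (Suc m) f I \<longleftrightarrow>
     (\<exists>f'. (\<forall>s\<in>I. (f has_vector_derivative f' s) (at s within I)) \<and> has_derivs_on m f' I)"

lemma has_derivs_on_if_times_differentiable_on:
  "times_differentiable_on m f I \<Longrightarrow> has_derivs_on m f I"
  by (induction m arbitrary: f) (auto intro: has_vector_derivative_vderiv)

lemma has_derivs_on_cong:
  assumes "\<And>s. s \<in> I \<Longrightarrow> f s = g s" and "has_derivs_on m f I"
  shows "has_derivs_on m g I"
proof (cases m)
  case (Suc m')
  have "(g has_vector_derivative d) (at s within I)"
    if "s \<in> I" "(f has_vector_derivative d) (at s within I)" for s d
    by (rule has_vector_derivative_transform[OF that(1) _ that(2)]) (simp add: assms(1))
  then show ?thesis
    using assms(2) unfolding Suc has_derivs_on.simps by blast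
qed simp

lemma has_derivs_on_SucD: "has_derivs_on (Suc m) f I \<Longrightarrow> has_derivs_on m f I"
proof (induction m arbitrary: f)
  case (Suc m)
  then obtain f' where "\<forall>s\<in>I. (f has_vector_derivative f' s) (at s within I)"
    "has_derivs_on (Suc m) f' I"
    unfolding has_derivs_on.simps(2)[of "Suc m"] by blast
  then show ?case
    using Suc.IH unfolding has_derivs_on.simps(2)[of m f] by blast
qed simp

lemma has_derivs_on_add:
  "has_derivs_on m f I \<Longrightarrow> has_derivs_on m g I \<Longrightarrow> has_derivs_on m (\<lambda>s. f s + g s) I"
proof (induction m arbitrary: f g)
  case (Suc m)
  then obtain f' g' where
    "\<forall>s\<in>I. (f has_vector_derivative f' s) (at s within I)" "has_derivs_on m f' I"
    "\<forall>s\<in>I. (g has_vector_derivative g' s) (at s within I)" "has_derivs_on m g' I"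
    by auto
  then show ?case
    using Suc.IH
    by (auto intro!: exI[of _ "\<lambda>s. f' s + g' s"] has_vector_derivative_add)
qed simp

lemma (in bounded_bilinear) has_derivs_on:
  "has_derivs_on m f I \<Longrightarrow> has_derivs_on m g I \<Longrightarrow> has_derivs_on m (\<lambda>s. prod (f s) (g s)) I"
proof (induction m arbitrary: f g)
  case (Suc m)
  then obtain f' g' where d:
    "\<forall>s\<in>I. (f has_vector_derivative f' s) (at s within I)" "has_derivs_on m f' I"
    "\<forall>s\<in>I. (g has_vector_derivative g' s) (at s within I)" "has_derivs_on m g' I"
    by auto
  let ?h = "\<lambda>s. prod (f s) (g' s) + prod (f' s) (g s)"
  have "has_derivs_on m ?h I"
    by (intro has_derivs_on_add Suc.IH d has_derivs_on_SucD[OF Suc.prems(1)]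
        has_derivs_on_SucD[OF Suc.prems(2)])
  moreover have "\<forall>s\<in>I. ((\<lambda>s. prod (f s) (g s)) has_vector_derivative ?h s) (at s within I)"
    using d(1,3) has_vector_derivative by blast
  ultimately show ?case
    unfolding has_derivs_on.simps by (intro exI[of _ ?h] conjI)
qed simp

lemma has_derivs_on_const: "has_derivs_on m (\<lambda>_. c) I"
  by (induction m arbitrary: c) (auto intro: has_vector_derivative_const)

text \<open>
  The function \<open>h = 1 / sqrt g\<close> solves \<open>h' = - g' h\<^sup>3 / 2\<close>, whose right-hand side is a product of
  functions already known to have one derivative less; so the induction closes without any general
  chain rule of higher order.
\<close>

lemma has_derivs_on_inverse_sqrt:
  fixes g :: "real \<Rightarrow> real"
  assumes "has_derivs_on m g I" and pos: "\<And>s. s \<in> I \<Longrightarrow> g s > 0"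
  shows "has_derivs_on m (\<lambda>s. inverse (sqrt (g s))) I"
  using assms(1)
proof (induction m)
  case (Suc m)
  define h where "h = (\<lambda>s. inverse (sqrt (g s)))"
  obtain g' where g': "\<forall>s\<in>I. (g has_vector_derivative g' s) (at s within I)"
    "has_derivs_on m g' I"
    using Suc.prems by auto
  have "has_derivs_on m h I"
    unfolding h_def by (rule Suc.IH[OF has_derivs_on_SucD[OF Suc.prems]])
  then have "has_derivs_on m (\<lambda>s. - 1 / 2 * (g' s * (h s * (h s * h s)))) I"
    by (intro bounded_bilinear.has_derivs_on[OF bounded_bilinear_mult] has_derivs_on_const g'(2))
  moreover have "(h has_vector_derivative - 1 / 2 * (g' s * (h s * (h s * h s)))) (at s within I)"
    if "s \<in> I" for s
  proof -
    have g0: "g s > 0" using pos that .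
    have "(g has_real_derivative g' s) (at s within I)"
      using g' that by (simp add: has_real_derivative_iff_has_vector_derivative)
    then have "((\<lambda>s. sqrt (g s)) has_real_derivative inverse (sqrt (g s)) / 2 * g' s)
        (at s within I)"
      by (rule DERIV_chain2[where f = sqrt and g = g, OF DERIV_real_sqrt[OF g0]])
    then have "(h has_real_derivative
        - (inverse (sqrt (g s)) * (inverse (sqrt (g s)) / 2 * g' s) * inverse (sqrt (g s))))
        (at s within I)"
      unfolding h_def using g0 by (intro DERIV_inverse') auto
    then show ?thesis
      by (simp add: has_real_derivative_iff_has_vector_derivative h_def mult_ac)
  qed
  ultimately show ?case
    unfolding has_derivs_on.simps h_def
    by (intro exI[of _ "\<lambda>s. - 1 / 2 * (g' s * (inverse (sqrt (g s)) *
        (inverse (sqrt (g s)) * inverse (sqrt (g s)))))"] conjI ballI)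
qed simp

lemma has_derivs_on_normalize:
  fixes f :: "real \<Rightarrow> 'a::real_inner"
  assumes f: "has_derivs_on m f I" and "\<And>s. s \<in> I \<Longrightarrow> f s \<noteq> 0"
  shows "has_derivs_on m (\<lambda>s. f s /\<^sub>R norm (f s)) I"
proof -
  have "has_derivs_on m (\<lambda>s. f s \<bullet> f s) I"
    by (rule bounded_bilinear.has_derivs_on[OF bounded_bilinear_inner f f])
  then have "has_derivs_on m (\<lambda>s. inverse (sqrt (f s \<bullet> f s))) I"
    by (rule has_derivs_on_inverse_sqrt) (simp add: assms(2))
  then have "has_derivs_on m (\<lambda>s. inverse (norm (f s))) I"
    by (simp only: norm_eq_sqrt_inner)
  then show ?thesis
    by (rule bounded_bilinear.has_derivs_on[OF bounded_bilinear_scaleR _ f])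
qed

section \<open>Unit fields and their normalised derivatives\<close>

definition normalized_deriv :: "real set \<Rightarrow> (real \<Rightarrow> real^3) \<Rightarrow> real \<Rightarrow> real^3" where
  "normalized_deriv I V = (\<lambda>s. vderiv I V s /\<^sub>R norm (vderiv I V s))"

text \<open>On a nondegenerate interval, these are exactly the tangent fields of curves with a Frenet frame.\<close>

definition regular_unit_field :: "real set \<Rightarrow> (real \<Rightarrow> real^3) \<Rightarrow> bool" where
  "regular_unit_field I V \<longleftrightarrow>
     V differentiable_on I \<and> (\<forall>s\<in>I. norm (V s) = 1 \<and> vderiv I V s \<noteq> 0)"

lemma frenet_N_eq_normalized_deriv: "frenet_N I c = normalized_deriv I (vderiv I c)"
  by (auto simp: frenet_N_def normalized_deriv_def)

lemma principal_normal_eq_funpow: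
  "principal_normal I \<gamma> k = (normalized_deriv I ^^ Suc k) (vderiv I \<gamma>)"
  by (induction k) (simp_all add: frenet_N_eq_normalized_deriv normalized_deriv_def)

lemma normalized_deriv_cong:
  assumes "s \<in> I" and "\<And>t. t \<in> I \<Longrightarrow> V t = W t"
  shows "normalized_deriv I V s = normalized_deriv I W s"
  using vderiv_cong[OF assms] by (simp add: normalized_deriv_def)

lemma norm_normalized_deriv:
  "regular_unit_field I V \<Longrightarrow> s \<in> I \<Longrightarrow> norm (normalized_deriv I V s) = 1"
  by (simp add: regular_unit_field_def normalized_deriv_def)

lemma has_derivs_on_normalized_deriv:
  assumes lim: "\<forall>s\<in>I. s islimpt I"
    and V: "regular_unit_field I V" and "has_derivs_on (Suc m) V I"
  shows "has_derivs_on m (normalized_deriv I V) I"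
proof -
  obtain V' where V': "\<forall>s\<in>I. (V has_vector_derivative V' s) (at s within I)"
    "has_derivs_on m V' I"
    using assms(3) by auto
  then have eq: "vderiv I V s = V' s" if "s \<in> I" for s
    using lim that by (intro vderiv_eqI) auto
  then have "has_derivs_on m (\<lambda>s. V' s /\<^sub>R norm (V' s)) I"
    using V V' by (intro has_derivs_on_normalize) (auto simp: regular_unit_field_def)
  then show ?thesis
    using eq by (elim has_derivs_on_cong[rotated]) (simp add: normalized_deriv_def)
qed

lemma inner_derivatives_of_constant_inner:
  fixes V W :: "real \<Rightarrow> 'a::real_inner"
  assumes "s islimpt I" and "s \<in> I"
    and "(V has_vector_derivative V') (at s within I)"
    and "(W has_vector_derivative W') (at s within I)"
    and "\<And>t. t \<in> I \<Longrightarrow> V t \<bullet> W t = c"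
  shows "V s \<bullet> W' + V' \<bullet> W s = 0"
proof -
  have "((\<lambda>t. V t \<bullet> W t) has_vector_derivative V s \<bullet> W' + V' \<bullet> W s) (at s within I)"
    by (rule bounded_bilinear.has_vector_derivative[OF bounded_bilinear_inner assms(3,4)])
  then have "((\<lambda>_. c) has_vector_derivative V s \<bullet> W' + V' \<bullet> W s) (at s within I)"
    by (rule has_vector_derivative_transform[rotated 2]) (use assms in auto)
  moreover have "((\<lambda>_. c) has_vector_derivative 0) (at s within I)"
    by (rule has_vector_derivative_const)
  ultimately show ?thesis
    using vector_derivative_unique_within assms(1) by (metis trivial_limit_within)
qed

text \<open>
  A normalised derivative \<open>N\<close> cannot be stationary: it is orthogonal to \<open>V\<close>, and while \<open>V\<close> moves in
  the direction of \<open>N\<close>, the field \<open>N\<close> has to move in the direction of \<open>- V\<close> at the same rate. For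
  \<open>V = T\<close> this is the term \<open>- \<kappa> T\<close> in the Frenet formula for \<open>N'\<close>.
\<close>

lemma regular_unit_field_normalized_deriv:
  assumes lim: "\<forall>s\<in>I. s islimpt I"
    and V: "regular_unit_field I V" and N: "normalized_deriv I V differentiable_on I"
  shows "regular_unit_field I (normalized_deriv I V)"
proof -
  let ?N = "normalized_deriv I V"
  have V_der: "(V has_vector_derivative vderiv I V s) (at s within I)" if "s \<in> I" for s
    using V that by (simp add: regular_unit_field_def has_vector_derivative_vderiv)
  have VV: "V s \<bullet> V s = 1" if "s \<in> I" for s
    using V that by (simp add: regular_unit_field_def flip: power2_norm_eq_inner)
  have VN: "V s \<bullet> ?N s = 0" if "s \<in> I" for s
    using inner_derivatives_of_constant_inner[OF _ that V_der[OF that] V_der[OF that] VV] lim that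
    by (simp add: normalized_deriv_def inner_commute)
  have "vderiv I ?N s \<noteq> 0" if s: "s \<in> I" for s
  proof
    assume "vderiv I ?N s = 0"
    then have "vderiv I V s \<bullet> ?N s = 0"
      using inner_derivatives_of_constant_inner[OF _ s V_der[OF s]
          has_vector_derivative_vderiv[OF N s] VN] lim s by simp
    then show False
      using V s by (simp add: normalized_deriv_def regular_unit_field_def)
  qed
  then show ?thesis
    using N norm_normalized_deriv[OF V] by (simp add: regular_unit_field_def)
qed

text \<open>
  The order is written \<open>Suc m\<close> because at least one derivative must be left over: the nonvanishing
  argument differentiates the normalised field itself.
\<close>

lemma regular_unit_field_funpow_normalized_deriv:
  assumes "\<forall>s\<in>I. s islimpt I" and "regular_unit_field I V" and "has_derivs_on (Suc m + k) V I"
  shows "regular_unit_field I ((normalized_deriv I ^^ k) V) \<and>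
    has_derivs_on (Suc m) ((normalized_deriv I ^^ k) V) I"
  using assms(3)
proof (induction k arbitrary: m)
  case 0
  then show ?case using assms(2) by simp
next
  case (Suc k)
  let ?W = "(normalized_deriv I ^^ k) V"
  have W: "regular_unit_field I ?W" "has_derivs_on (Suc (Suc m)) ?W I"
    using Suc.IH[of "Suc m"] Suc.prems by auto
  then have N: "has_derivs_on (Suc m) (normalized_deriv I ?W) I"
    by (rule has_derivs_on_normalized_deriv[OF assms(1)])
  then have "normalized_deriv I ?W differentiable_on I"
    by (auto simp: differentiable_on_def intro: differentiableI_vector)
  then show ?case
    using regular_unit_field_normalized_deriv[OF assms(1) W(1)] N by simp
qed

section \<open>Principal direction curves and slant helices\<close>

lemma vderiv_principal_direction_curve:
  assumes lim: "\<forall>s\<in>I. s islimpt I"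
    and "principal_direction_curve I \<gamma> k c" and "s \<in> I"
  shows "(c has_vector_derivative (normalized_deriv I ^^ k) (vderiv I \<gamma>) s) (at s within I)"
  using assms(2,3)
proof (induction k arbitrary: c s)
  case 0
  then show ?case by (simp add: antiderivative_on_def frenet_T_def)
next
  case (Suc k)
  then obtain d where d: "principal_direction_curve I \<gamma> k d"
    and c: "antiderivative_on I (frenet_N I d) c"
    by auto
  have "vderiv I d t = (normalized_deriv I ^^ k) (vderiv I \<gamma>) t" if "t \<in> I" for t
    using lim that by (intro vderiv_eqI Suc.IH[OF d]) auto
  then have "frenet_N I d s = (normalized_deriv I ^^ Suc k) (vderiv I \<gamma>) s"
    unfolding frenet_N_eq_normalized_deriv funpow.simps o_apply
    by (rule normalized_deriv_cong[OF Suc.prems(2)])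
  moreover have "(c has_vector_derivative frenet_N I d s) (at s within I)"
    using c Suc.prems(2) by (simp add: antiderivative_on_def)
  ultimately show ?case by (simp only:)
qed

lemma has_frenet_frame_if_regular_tangent:
  assumes lim: "\<forall>s\<in>I. s islimpt I" and V: "regular_unit_field I V"
    and c: "\<forall>s\<in>I. (c has_vector_derivative V s) (at s within I)"
  shows "has_frenet_frame I c"
proof -
  have eq: "vderiv I c s = V s" if "s \<in> I" for s
    using lim c that by (intro vderiv_eqI) auto
  have "vderiv I c differentiable_on I"
    unfolding differentiable_on_def
  proof
    fix s assume s: "s \<in> I"
    have "(V has_vector_derivative vderiv I V s) (at s within I)"
      using V s by (simp add: regular_unit_field_def has_vector_derivative_vderiv)
    then have "(vderiv I c has_vector_derivative vderiv I V s) (at s within I)"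
      by (rule has_vector_derivative_transform[OF s, rotated]) (simp add: eq)
    then show "vderiv I c differentiable (at s within I)"
      by (rule differentiableI_vector)
  qed
  moreover have "vderiv I (vderiv I c) s = vderiv I V s" if "s \<in> I" for s
    using vderiv_cong[OF that eq] .
  moreover have "c differentiable_on I"
    using c by (auto simp: differentiable_on_def intro: differentiableI_vector)
  ultimately show ?thesis
    using V eq by (simp add: has_frenet_frame_def unit_speed_curve_def regular_unit_field_def)
qed

text \<open>
  A constant inner product of unit vectors lies in \<open>[-1, 1]\<close> by the Cauchy-Schwarz inequality, hence
  is the cosine of an angle; evaluating at a point of \<open>I\<close> is what bounds the constant.
\<close>

lemma constant_angle_with_unit_iff:
  assumes "I \<noteq> {}" and "norm u = 1" and unit: "\<forall>s\<in>I. norm (V s) = 1"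
  shows "constant_angle_with I V u \<longleftrightarrow> (\<exists>a. \<forall>s\<in>I. V s \<bullet> u = a)"
proof
  assume "\<exists>a. \<forall>s\<in>I. V s \<bullet> u = a"
  then obtain a where a: "\<forall>s\<in>I. V s \<bullet> u = a" by blast
  obtain s where s: "s \<in> I" using assms(1) by blast
  have "\<bar>a\<bar> \<le> 1"
    using Cauchy_Schwarz_ineq2[of "V s" u] a s assms by simp
  then have "arccos a \<in> {0..pi}" "cos (arccos a) = a"
    by (auto intro: arccos_lbound arccos_ubound)
  then show "constant_angle_with I V u"
    unfolding constant_angle_with_def using a assms by (intro bexI[of _ "arccos a"]) auto
qed (use assms in \<open>auto simp: constant_angle_with_def\<close>)

theorem theorem1:
  fixes I :: "real set" and \<gamma> \<gamma>\<^sub>k :: "real \<Rightarrow> real^3" and n k :: nat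
  assumes "is_interval I" and "interior I \<noteq> {}"
    and "1 \<le> n"
    and "times_differentiable_on (n + 2) \<gamma> I"
    and "has_frenet_frame I \<gamma>"
    and "1 \<le> k" and "k \<le> n"
    and "principal_direction_curve I \<gamma> k \<gamma>\<^sub>k"
  shows "N_slant_helix I k \<gamma> \<longleftrightarrow> slant_helix I \<gamma>\<^sub>k"
proof -
  have lim: "\<forall>s\<in>I. s islimpt I"
    using islimpt_nondegenerate_interval assms(1,2) by blast
  have ne: "I \<noteq> {}" using assms(2) by auto
  let ?T = "(normalized_deriv I ^^ k) (vderiv I \<gamma>)"
  have "regular_unit_field I (vderiv I \<gamma>)"
    using assms(5) by (simp add: has_frenet_frame_def unit_speed_curve_def regular_unit_field_def)
  moreover have "has_derivs_on (Suc (n - k) + k) (vderiv I \<gamma>) I"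
    using assms(4,7) by (intro has_derivs_on_if_times_differentiable_on) simp
  ultimately have T: "regular_unit_field I ?T"
    using regular_unit_field_funpow_normalized_deriv[OF lim] by blast
  have \<gamma>\<^sub>k: "\<forall>s\<in>I. (\<gamma>\<^sub>k has_vector_derivative ?T s) (at s within I)"
    using vderiv_principal_direction_curve[OF lim assms(8)] by blast
  then have "vderiv I \<gamma>\<^sub>k s = ?T s" if "s \<in> I" for s
    using lim that by (intro vderiv_eqI) auto
  then have N: "frenet_N I \<gamma>\<^sub>k s = normalized_deriv I ?T s" if "s \<in> I" for s
    unfolding frenet_N_eq_normalized_deriv using that by (rule normalized_deriv_cong[rotated])
  have "constant_angle_with I (frenet_N I \<gamma>\<^sub>k) u \<longleftrightarrow>
      (\<exists>a. \<forall>s\<in>I. principal_normal I \<gamma> k s \<bullet> u = a)" if "norm u = 1" for u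
    using constant_angle_with_unit_iff[OF ne that, of "frenet_N I \<gamma>\<^sub>k"] N
      norm_normalized_deriv[OF T]
    by (simp add: principal_normal_eq_funpow)
  then show ?thesis
    using has_frenet_frame_if_regular_tangent[OF lim T \<gamma>\<^sub>k]
    by (auto simp: N_slant_helix_def slant_helix_def)
qed

end
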